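(* Let $(P,A,\lambda)$ be a marked poset with $|P|=n$ and marked elements $A=\{p_1,\dots,p_k\}$ labeled so that $\lambda_1\ge\cdots\ge\lambda_k$, where $\lambda_i=\lambda(p_i)$, and so that $p_i>p_j$ in $P$ implies $i<j$. Then $$\mathrm{Vol}\,\widetilde{\mathcal{O}}(P,A)_\lambda=\sum_{a_1,\dots,a_{k-1}\ge0}N_{P,A,\lambda}(a_1,\dots,a_{k-1})\,\frac{(\lambda_1-\lambda_2)^{a_1}}{a_1!}\cdots\frac{(\lambda_{k-1}-\lambda_k)^{a_{k-1}}}{a_{k-1}!}.$$
   Context: A marked poset $(P,A,\lambda)$ consists of a finite poset $P$, a subposet $A\subseteq P$ containing all minimal and all maximal elements of $P$, and an order-preserving map $\lambda:A\to\mathbb{R}$. Its marked order polytope is $\mathcal{O}(P,A)_\lambda=\{x\in\mathbb{R}^P: x_p\le x_q\text{ whenever }p<q\text{ in }P,\ x_a=\lambda(a)\text{ for }a\in A\}$, and $\widetilde{\mathcal{O}}(P,A)_\lambda$ is its projection onto the coordinates indexed by $P\setminus A$; $\mathrm{Vol}$ denotes $|P\setminus A|$-dimensional Euclidean volume in $\mathbb{R}^{P\setminus A}$. A linear extension of $P$ is an order-reversing bijection $\sigma:[n]\to P$ (i.e. $p<q$ in $P$ implies $\sigma^{-1}(p)>\sigma^{-1}(q)$; so $\sigma(1)$ is maximal). $N_{P,A,\lambda}(a_1,\dots,a_{k-1})$ is the number of linear extensions $\sigma$ of $P$ such that $\sigma(j+a_1+\cdots+a_{j-1})=p_j$ for every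 $j\in[k]$ (i.e. $p_1,\dots,p_k$ occur at positions $1,\,2+a_1,\,\dots,\,k+a_1+\cdots+a_{k-1}$). *)

theory Defs
  imports "HOL-Analysis.Analysis"
begin

definition marked_poset :: "'a::order set \<Rightarrow> 'a set \<Rightarrow> ('a \<Rightarrow> real) \<Rightarrow> bool" where
  "marked_poset P A lam \<longleftrightarrow> finite P \<and> A \<subseteq> P
     \<and> (\<forall>p\<in>P. (\<forall>q\<in>P. \<not> q < p) \<longrightarrow> p \<in> A)
     \<and> (\<forall>p\<in>P. (\<forall>q\<in>P. \<not> p < q) \<longrightarrow> p \<in> A)
     \<and> (\<forall>a\<in>A. \<forall>b\<in>A. a \<le> b \<longrightarrow> lam a \<le> lam b)"

definition marked_order_polytope :: "'a::order set \<Rightarrow> 'a set \<Rightarrow> ('a \<Rightarrow> real) \<Rightarrow> ('a \<Rightarrow> real) set" where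
  "marked_order_polytope P A lam =
     {x \<in> P \<rightarrow>\<^sub>E UNIV. (\<forall>p\<in>P. \<forall>q\<in>P. p < q \<longrightarrow> x p \<le> x q) \<and> (\<forall>a\<in>A. x a = lam a)}"

definition proj_marked_order_polytope :: "'a::order set \<Rightarrow> 'a set \<Rightarrow> ('a \<Rightarrow> real) \<Rightarrow> ('a \<Rightarrow> real) set" where
  "proj_marked_order_polytope P A lam = (\<lambda>x. restrict x (P - A)) ` marked_order_polytope P A lam"

definition vol_proj :: "'a::order set \<Rightarrow> 'a set \<Rightarrow> ('a \<Rightarrow> real) \<Rightarrow> real" where
  "vol_proj P A lam = measure (PiM (P - A) (\<lambda>_. lborel)) (proj_marked_order_polytope P A lam)"

definition linear_extensions :: "'a::order set \<Rightarrow> (nat \<Rightarrow> 'a) set" where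
  "linear_extensions P = {\<sigma> \<in> {1..card P} \<rightarrow>\<^sub>E P. bij_betw \<sigma> {1..card P} P \<and>
      (\<forall>i\<in>{1..card P}. \<forall>j\<in>{1..card P}. \<sigma> i < \<sigma> j \<longrightarrow> j < i)}"

text \<open>N(a_1,...,a_{k-1}); the list as has as!(i-1) = a_i. p_j must sit at position
  j + a_1 + ... + a_{j-1}.\<close>
definition N_count :: "'a::order set \<Rightarrow> (nat \<Rightarrow> 'a) \<Rightarrow> nat \<Rightarrow> nat list \<Rightarrow> nat" where
  "N_count P p k as = card {\<sigma> \<in> linear_extensions P.
      \<forall>j\<in>{1..k}. j + sum_list (take (j - 1) as) \<le> card P \<and>
                 \<sigma> (j + sum_list (take (j - 1) as)) = p j}"

end

theory Submission
  imports Defs "HOL-Library.List_Lexorder"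
begin

text \<open>Almost every point of the polytope has pairwise distinct free coordinates, none of them equal
  to a marked value. Sorting the elements of $P$ by decreasing coordinate, with ties between
  marked elements resolved by their labels, then gives a unique linear extension, in which
  $p_1, \dots, p_k$ appear in this order. Hence the polytope is, up to null sets, a disjoint union
  of chain regions, one for each such linear extension. By Fubini, a run of $a$ free elements
  between the marked values $\lambda_i \ge \lambda_{i+1}$ contributes the factor
  $(\lambda_i - \lambda_{i+1})^a / a!$ to the volume of the chain region.\<close>

subsection \<open>Volume of a chain region\<close>

text \<open>Points live on the free coordinates only; filling in the marked values lets free and
  marked elements enter every inequality in the same way.\<close>

definition marked_ext :: "'a set \<Rightarrow> ('a \<Rightarrow> real) \<Rightarrow> ('a \<Rightarrow> real) \<Rightarrow> 'a \<Rightarrow> real" where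
  "marked_ext A lam x q = (if q \<in> A then lam q else x q)"

lemma marked_ext_measurable [measurable]:
  assumes "q \<in> A \<or> q \<in> U"
  shows "(\<lambda>x. marked_ext A lam x q) \<in> borel_measurable (PiM U (\<lambda>_. lborel))"
  using assms by (cases "q \<in> A") (auto simp: marked_ext_def)

text \<open>The upper bound \<open>t\<close> is the parameter of the recursion: peeling off the
  first letter of \<open>ws\<close> leaves a region of the same kind, bounded by the value of that
  letter. The ambient space has one coordinate for each unmarked letter of
  \<open>ws\<close>.\<close>

definition chain_region :: "'a set \<Rightarrow> ('a \<Rightarrow> real) \<Rightarrow> real \<Rightarrow> 'a list \<Rightarrow> ('a \<Rightarrow> real) set" where
  "chain_region A lam t ws =
     {x \<in> space (PiM (set ws - A) (\<lambda>_. lborel)). sorted_wrt (\<ge>) (t # map (marked_ext A lam x) ws)}"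

lemma sorted_wrt_measurable:
  assumes "\<And>f. f \<in> set fs \<Longrightarrow> f \<in> borel_measurable M"
  shows "Measurable.pred M (\<lambda>x. sorted_wrt (\<ge>) (map (\<lambda>f. f x :: real) fs))"
  using assms
proof (induction fs)
  case (Cons f fs)
  have [measurable]: "f \<in> borel_measurable M" "\<And>g. g \<in> set fs \<Longrightarrow> g \<in> borel_measurable M"
    "Measurable.pred M (\<lambda>x. sorted_wrt (\<ge>) (map (\<lambda>f. f x) fs))"
    using Cons by auto
  have "Measurable.pred M (\<lambda>x. (\<forall>g\<in>set fs. g x \<le> f x) \<and> sorted_wrt (\<ge>) (map (\<lambda>f. f x) fs))"
    by measurable
  then show ?case by simp
qed simp

lemma chain_region_sets [measurable]:
  "chain_region A lam t ws \<in> sets (PiM (set ws - A) (\<lambda>_. lborel))"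
proof -
  let ?M = "PiM (set ws - A) (\<lambda>_. lborel :: real measure)"
  let ?fs = "(\<lambda>_. t) # map (\<lambda>q x. marked_ext A lam x q) ws"
  have "Measurable.pred ?M (\<lambda>x. sorted_wrt (\<ge>) (map (\<lambda>f. f x) ?fs))"
    by (rule sorted_wrt_measurable) auto
  then show ?thesis
    by (simp add: chain_region_def pred_def comp_def)
qed

text \<open>A marked letter has no coordinate, so the ambient space stays the same. Its value is
  tested against \<open>t\<close> and then becomes the new bound.\<close>

lemma chain_region_Cons_marked:
  assumes "a \<in> A"
  shows "chain_region A lam t (a # ws) = (if lam a \<le> t then chain_region A lam (lam a) ws else {})"
proof -
  have U: "set (a # ws) - A = set ws - A" using assms by auto
  have ext: "marked_ext A lam x a = lam a" for x using assms by (simp add: marked_ext_def)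
  have "sorted_wrt (\<ge>) (t # lam a # xs) \<longleftrightarrow> lam a \<le> t \<and> sorted_wrt (\<ge>) (lam a # xs)" for xs
    by auto
  then show ?thesis by (simp only: chain_region_def U list.map ext) simp
qed

lemma nn_integral_power_Icc:
  fixes s t K :: real
  assumes "s \<le> t"
  shows "(\<integral>\<^sup>+y. ennreal ((y - s) ^ m / fact m) * indicator {s..t} y \<partial>lborel)
    = ennreal ((t - s) ^ Suc m / fact (Suc m))"
proof -
  have "((\<lambda>y. (y - s) ^ Suc m / fact (Suc m)) has_real_derivative (y - s) ^ m / fact m) (at y)" for y
  proof -
    have "((\<lambda>y. (y - s) ^ Suc m / fact (Suc m)) has_real_derivative
        (real (Suc m) * (y - s) ^ m) / fact (Suc m)) (at y)"
      by (auto intro!: derivative_eq_intros simp del: power_Suc fact_Suc of_nat_Suc)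
    then show ?thesis by (simp del: of_nat_Suc)
  qed
  from nn_integral_FTC_Icc[OF _ this _ assms] show ?thesis by simp
qed

text \<open>Induction on the run \<open>us\<close>: integrating over its first coordinate raises the
  simplex volume by one degree. The marked letter \<open>a\<close> resets the bound to
  \<open>lam a\<close>, so the second factor does not depend on \<open>t\<close>. The case
  \<open>t < lam a\<close> has to be covered because the bound becomes the integration
  variable.\<close>

lemma emeasure_chain_region_unmarked_run:
  assumes "distinct (us @ a # ws)" "set us \<inter> A = {}" "a \<in> A"
  shows "emeasure (PiM (set (us @ a # ws) - A) (\<lambda>_. lborel)) (chain_region A lam t (us @ a # ws)) =
    ennreal (if lam a \<le> t then (t - lam a) ^ length us / fact (length us) else 0) *
    emeasure (PiM (set ws - A) (\<lambda>_. lborel)) (chain_region A lam (lam a) ws)"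
  using assms
proof (induction us arbitrary: t)
  case Nil
  then have "set ([] @ a # ws) - A = set ws - A" by auto
  then show ?case using Nil by (simp only: append_Nil chain_region_Cons_marked) simp
next
  case (Cons u us)
  interpret product_sigma_finite "\<lambda>_::'a. lborel :: real measure" ..
  define vs where "vs = us @ a # ws"
  define V where "V = set vs - A"
  define l where "l = lam a"
  define m where "m = length us"
  let ?M = "\<lambda>U. PiM U (\<lambda>_. lborel :: real measure)"
  let ?K = "emeasure (?M (set ws - A)) (chain_region A lam l ws)"
  have u: "u \<notin> A" "u \<notin> set vs" "u \<notin> V" and V: "finite V" and UV: "set (u # vs) - A = insert u V"
    using Cons.prems by (auto simp: vs_def V_def)
  have ms: "chain_region A lam t (u # vs) \<in> sets (?M (insert u V))"
    using chain_region_sets[of A lam t "u # vs"] UV by simp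
  \<comment> \<open>Fixing the coordinate of \<open>u\<close> at \<open>y\<close> leaves the region
    of the tail with bound \<open>y\<close>, provided that \<open>y \<le> t\<close>.\<close>
  have sec: "x(u := y) \<in> chain_region A lam t (u # vs) \<longleftrightarrow> y \<le> t \<and> x \<in> chain_region A lam y vs"
    if "x \<in> space (?M V)" for x y
  proof -
    have "x(u := y) \<in> space (?M (insert u V))"
      using that by (auto simp: space_PiM PiE_def extensional_def)
    moreover have "map (marked_ext A lam (x(u := y))) vs = map (marked_ext A lam x) vs"
      using u by (auto simp: marked_ext_def)
    moreover have "marked_ext A lam (x(u := y)) u = y" using u by (simp add: marked_ext_def)
    ultimately have "x(u := y) \<in> chain_region A lam t (u # vs) \<longleftrightarrow>
        sorted_wrt (\<ge>) (t # y # map (marked_ext A lam x) vs)"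
      by (simp only: chain_region_def mem_Collect_eq UV list.map simp_thms)
    also have "\<dots> \<longleftrightarrow> y \<le> t \<and> sorted_wrt (\<ge>) (y # map (marked_ext A lam x) vs)"
      by auto
    also have "\<dots> \<longleftrightarrow> y \<le> t \<and> x \<in> chain_region A lam y vs"
      using that by (simp only: chain_region_def mem_Collect_eq V_def simp_thms)
    finally show ?thesis .
  qed
  have "emeasure (?M (insert u V)) (chain_region A lam t (u # vs))
    = (\<integral>\<^sup>+x. indicator (chain_region A lam t (u # vs)) x \<partial>?M (insert u V))"
    using ms by simp
  \<comment> \<open>Fubini with the coordinate of \<open>u\<close> as the outer variable, so that
    the inner integral is the measure of a section.\<close>
  also have "\<dots> = (\<integral>\<^sup>+y. (\<integral>\<^sup>+x. indicator (chain_region A lam t (u # vs)) (x(u := y)) \<partial>?M V) \<partial>lborel)"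
    using V u(3) ms by (intro product_nn_integral_insert_rev) auto
  also have "\<dots> = (\<integral>\<^sup>+y. indicator {..t} y * emeasure (?M V) (chain_region A lam y vs) \<partial>lborel)"
  proof (rule nn_integral_cong)
    fix y
    have "(\<integral>\<^sup>+x. indicator (chain_region A lam t (u # vs)) (x(u := y)) \<partial>?M V)
      = (\<integral>\<^sup>+x. indicator {..t} y * indicator (chain_region A lam y vs) x \<partial>?M V)"
      by (rule nn_integral_cong) (auto simp: sec split: split_indicator)
    also have "\<dots> = indicator {..t} y * emeasure (?M V) (chain_region A lam y vs)"
      by (subst nn_integral_cmult) (auto simp: V_def)
    finally show "(\<integral>\<^sup>+x. indicator (chain_region A lam t (u # vs)) (x(u := y)) \<partial>?M V)
      = indicator {..t} y * emeasure (?M V) (chain_region A lam y vs)" .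
  qed
  \<comment> \<open>By the induction hypothesis the sections are null below \<open>l\<close>, which
    cuts the range of integration down to \<open>{l..t}\<close>; the factor \<open>?K\<close> is
    constant in \<open>y\<close>.\<close>
  also have "\<dots> = (\<integral>\<^sup>+y. (ennreal ((y - l) ^ m / fact m) * indicator {l..t} y) * ?K \<partial>lborel)"
  proof (rule nn_integral_cong)
    fix y
    have "emeasure (?M V) (chain_region A lam y vs) =
      ennreal (if l \<le> y then (y - l) ^ m / fact m else 0) * ?K"
      using Cons.IH[of y] Cons.prems by (simp add: vs_def V_def l_def m_def)
    then show "indicator {..t} y * emeasure (?M V) (chain_region A lam y vs)
      = (ennreal ((y - l) ^ m / fact m) * indicator {l..t} y) * ?K"
      by (auto split: split_indicator)
  qed
  also have "\<dots> = (\<integral>\<^sup>+y. ennreal ((y - l) ^ m / fact m) * indicator {l..t} y \<partial>lborel) * ?K"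
    by (rule nn_integral_multc) auto
  also have "(\<integral>\<^sup>+y. ennreal ((y - l) ^ m / fact m) * indicator {l..t} y \<partial>lborel)
    = ennreal (if l \<le> t then (t - l) ^ Suc m / fact (Suc m) else 0)"
    by (cases "l \<le> t") (simp_all add: nn_integral_power_Icc del: power_Suc fact_Suc)
  finally show ?case
    by (simp only: UV[symmetric] vs_def l_def m_def append_Cons length_Cons)
qed

text \<open>Induction on the list of gap lengths: each step removes one marked letter together with
  the run of free letters after it, and collects the factor of that run. Labels and positions count
  from 0 here, and the marked letters sit exactly at the positions
  \<open>j + sum_list (take j as)\<close>.\<close>

lemma emeasure_chain_region:
  assumes "distinct ws"
    and "\<And>j. j \<le> length as \<Longrightarrow> q j \<in> A"
    and "\<And>j. j \<le> length as \<Longrightarrow> ws ! (j + sum_list (take j as)) = q j"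
    and "length ws = Suc (length as + sum_list as)"
    and "\<And>i. i < length ws \<Longrightarrow> ws ! i \<in> A \<Longrightarrow> \<exists>j\<le>length as. i = j + sum_list (take j as)"
    and "\<And>j. j < length as \<Longrightarrow> lam (q (Suc j)) \<le> lam (q j)"
  shows "emeasure (PiM (set ws - A) (\<lambda>_. lborel)) (chain_region A lam (lam (q 0)) ws) =
    ennreal (\<Prod>i<length as. (lam (q i) - lam (q (Suc i))) ^ (as ! i) / fact (as ! i))"
  using assms
proof (induction as arbitrary: ws q)
  case Nil
  then obtain w where w: "ws = [w]" by (auto simp: length_Suc_conv)
  then have [simp]: "w = q 0" "q 0 \<in> A" using Nil.prems(2,3)[of 0] by auto
  interpret product_sigma_finite "\<lambda>_::'a. lborel :: real measure" ..
  \<comment> \<open>Without free coordinates the product measure lives on a single point, which has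
    mass 1.\<close>
  show ?case
    by (simp add: w chain_region_Cons_marked) (simp add: chain_region_def space_PiM PiM_empty)
next
  case (Cons a as)
  define vs where "vs = tl ws"
  \<comment> \<open>The word splits as \<open>q 0\<close>, then the run \<open>us\<close> of
    \<open>a\<close> free letters, then the rest \<open>rs\<close>, which starts with
    \<open>q 1\<close>.\<close>
  define us where "us = take a vs"
  define rs where "rs = drop a vs"
  have len: "length vs = a + Suc (length as + sum_list as)" using Cons.prems(4) by (simp add: vs_def)
  have ws: "ws = q 0 # vs"
    using Cons.prems(3)[of 0] Cons.prems(4) by (cases ws) (auto simp: vs_def)
  have vs: "vs = us @ rs" "length us = a" "length rs = Suc (length as + sum_list as)"
    using len by (auto simp: us_def rs_def)
  have wsr: "ws ! (Suc a + i) = rs ! i" for i by (simp add: ws vs nth_append)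
  have rs_q: "rs ! (j + sum_list (take j as)) = q (Suc j)" if "j \<le> length as" for j
    using Cons.prems(3)[of "Suc j"] that by (simp add: wsr[symmetric] add_ac)
  obtain rs' where rs: "rs = q 1 # rs'"
    using rs_q[of 0] vs(3) by (cases rs) auto
  \<comment> \<open>Letters of \<open>us\<close> have positions from 1 to \<open>a\<close> in
    \<open>ws\<close>, whereas the marked positions are 0 and numbers of size at least
    \<open>a + 1\<close>.\<close>
  have us_A: "set us \<inter> A = {}"
  proof (rule ccontr)
    assume "set us \<inter> A \<noteq> {}"
    then obtain i where i: "i < a" "us ! i \<in> A" using vs(2) by (metis disjoint_iff in_set_conv_nth)
    then have "ws ! (Suc i) \<in> A" "Suc i < length ws" using vs len by (auto simp: ws nth_append)
    from Cons.prems(5)[OF this(2,1)] obtain j where "Suc i = j + sum_list (take j (a # as))" by blast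
    then show False using i by (cases j) auto
  qed
  have q0: "q 0 \<in> A" and q1: "q 1 \<in> A" using Cons.prems(2)[of 0] Cons.prems(2)[of 1] by auto
  have le: "lam (q 1) \<le> lam (q 0)" using Cons.prems(6)[of 0] by simp
  have IH: "emeasure (PiM (set rs - A) (\<lambda>_. lborel)) (chain_region A lam (lam (q (Suc 0))) rs) =
    ennreal (\<Prod>i<length as. (lam (q (Suc i)) - lam (q (Suc (Suc i)))) ^ (as ! i) / fact (as ! i))"
  proof (rule Cons.IH[where q = "\<lambda>i. q (Suc i)"])
    show "distinct rs" using Cons.prems(1) by (simp add: ws vs)
    show "length rs = Suc (length as + sum_list as)" by (fact vs(3))
    show "rs ! (j + sum_list (take j as)) = q (Suc j)" if "j \<le> length as" for j
      using rs_q that .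
    show "q (Suc j) \<in> A" if "j \<le> length as" for j
      using Cons.prems(2)[of "Suc j"] that by simp
    show "lam (q (Suc (Suc j))) \<le> lam (q (Suc j))" if "j < length as" for j
      using Cons.prems(6)[of "Suc j"] that by simp
    show "\<exists>j\<le>length as. i = j + sum_list (take j as)" if i: "i < length rs" "rs ! i \<in> A" for i
    proof -
      have "Suc a + i < length ws" "ws ! (Suc a + i) \<in> A"
        using i vs(2,3) by (simp_all only: wsr) (simp_all add: ws vs(1))
      from Cons.prems(5)[OF this] obtain j
        where "j \<le> length (a # as)" "Suc a + i = j + sum_list (take j (a # as))" by blast
      then show ?thesis by (cases j) auto
    qed
  qed
  have set_rs: "set rs - A = set rs' - A" using q1 by (auto simp: rs)
  have "emeasure (PiM (set ws - A) (\<lambda>_. lborel)) (chain_region A lam (lam (q 0)) ws)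
    = emeasure (PiM (set (us @ q 1 # rs') - A) (\<lambda>_. lborel))
        (chain_region A lam (lam (q 0)) (us @ q 1 # rs'))"
  proof -
    have "set ws - A = set (us @ q 1 # rs') - A" using q0 by (auto simp: ws vs rs)
    then show ?thesis by (simp only:) (simp add: ws vs rs chain_region_Cons_marked q0)
  qed
  also have "\<dots> = ennreal ((lam (q 0) - lam (q 1)) ^ a / fact a) *
    emeasure (PiM (set rs' - A) (\<lambda>_. lborel)) (chain_region A lam (lam (q 1)) rs')"
    using Cons.prems(1) us_A q1 le vs(2)
    by (subst emeasure_chain_region_unmarked_run) (auto simp: ws vs(1) rs)
  \<comment> \<open>The induction hypothesis speaks of \<open>rs\<close>, which still carries its
    head \<open>q 1\<close>. Dropping this marked head changes neither the ambient space nor the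
    bound \<open>lam (q 1)\<close>.\<close>
  also have "emeasure (PiM (set rs' - A) (\<lambda>_. lborel)) (chain_region A lam (lam (q 1)) rs') =
    ennreal (\<Prod>i<length as. (lam (q (Suc i)) - lam (q (Suc (Suc i)))) ^ (as ! i) / fact (as ! i))"
    using IH unfolding set_rs by (simp add: rs chain_region_Cons_marked q1[simplified])
  finally show ?case
    using le by (simp add: ennreal_mult'[symmetric] prod.lessThan_Suc_shift del: prod.lessThan_Suc)
qed

lemma sum_list_take_mono:
  fixes xs :: "nat list"
  assumes "i \<le> j"
  shows "sum_list (take i xs) \<le> sum_list (take j xs)"
proof -
  obtain d where "j = i + d" using assms le_Suc_ex by blast
  then show ?thesis by (simp add: take_add)
qed

section \<open>Increasing enumerations of a finite set with respect to an injective key\<close>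

lemma ex_increasing_enum:
  fixes f :: "'a \<Rightarrow> 'b::linorder"
  assumes "finite P" "inj_on f P"
  obtains \<sigma> where "\<sigma> \<in> {1..card P} \<rightarrow>\<^sub>E P" "bij_betw \<sigma> {1..card P} P"
    "\<And>i j. 1 \<le> i \<Longrightarrow> i < j \<Longrightarrow> j \<le> card P \<Longrightarrow> f (\<sigma> i) < f (\<sigma> j)"
proof -
  define ks where "ks = sorted_list_of_set (f ` P)"
  have fin: "finite (f ` P)" using assms(1) by simp
  have len: "length ks = card P"
    unfolding ks_def length_sorted_list_of_set by (rule card_image[OF assms(2)])
  have set_ks: "set ks = f ` P"
    unfolding ks_def by (rule set_sorted_list_of_set[OF fin])
  have srt: "sorted_wrt (<) ks" unfolding ks_def by simp
  have "bij_betw (\<lambda>i. i - 1) {1..card P} {..<card P}"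
    by (rule bij_betw_byWitness[where f' = Suc]) auto
  moreover have "bij_betw ((!) ks) {..<card P} (f ` P)"
    by (rule bij_betw_nth) (simp_all add: len set_ks strict_sorted_iff[THEN iffD1, OF srt])
  moreover have "bij_betw (inv_into P f) (f ` P) P"
    using assms(2) by (simp add: bij_betw_inv_into inj_on_imp_bij_betw)
  ultimately have bij: "bij_betw (inv_into P f \<circ> ((!) ks \<circ> (\<lambda>i. i - 1))) {1..card P} P"
    by (blast intro: bij_betw_trans)
  \<comment> \<open>The element at position \<open>i\<close> is the preimage of the
    \<open>i\<close>-th smallest key; positions count from 1 and list indices from 0.\<close>
  define \<sigma> where "\<sigma> = (\<lambda>i\<in>{1..card P}. inv_into P f (ks ! (i - 1)))"
  have bij': "bij_betw \<sigma> {1..card P} P"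
    using bij by (rule bij_betw_cong[THEN iffD1, rotated]) (simp add: \<sigma>_def)
  have f\<sigma>: "f (\<sigma> i) = ks ! (i - 1)" if "i \<in> {1..card P}" for i
  proof -
    have "ks ! (i - 1) \<in> f ` P" using that len set_ks nth_mem[of "i - 1" ks] by auto
    then show ?thesis using that by (simp add: \<sigma>_def f_inv_into_f)
  qed
  show ?thesis
  proof
    show "\<sigma> \<in> {1..card P} \<rightarrow>\<^sub>E P"
      using bij' by (auto simp: \<sigma>_def PiE_iff bij_betw_def)
    show "f (\<sigma> i) < f (\<sigma> j)" if "1 \<le> i" "i < j" "j \<le> card P" for i j
      using that srt len by (simp add: f\<sigma> sorted_wrt_iff_nth_less)
  qed (fact bij')
qed

text \<open>Both enumerations produce the same strictly sorted list of keys, and injectivity of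
  \<open>f\<close> carries this back to the elements.\<close>

lemma increasing_enum_unique:
  fixes f :: "'a \<Rightarrow> 'b::linorder" and n :: nat
  assumes "inj_on f P"
    and "\<sigma> \<in> {1..n} \<rightarrow>\<^sub>E P" "bij_betw \<sigma> {1..n} P" "\<And>i j. 1 \<le> i \<Longrightarrow> i < j \<Longrightarrow> j \<le> n \<Longrightarrow> f (\<sigma> i) < f (\<sigma> j)"
    and "\<tau> \<in> {1..n} \<rightarrow>\<^sub>E P" "bij_betw \<tau> {1..n} P" "\<And>i j. 1 \<le> i \<Longrightarrow> i < j \<Longrightarrow> j \<le> n \<Longrightarrow> f (\<tau> i) < f (\<tau> j)"
  shows "\<sigma> = \<tau>"
proof -
  have set_upt: "set [1..<Suc n] = {1..n}" by auto
  have srt: "sorted_wrt (<) (map (f \<circ> \<rho>) [1..<Suc n])"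
    if "\<And>i j. 1 \<le> i \<Longrightarrow> i < j \<Longrightarrow> j \<le> n \<Longrightarrow> f (\<rho> i) < f (\<rho> j)" for \<rho>
    using that by (simp add: sorted_wrt_iff_nth_less del: upt_Suc)
  have img: "set (map (f \<circ> \<rho>) [1..<Suc n]) = f ` P" if "bij_betw \<rho> {1..n} P" for \<rho>
    using that by (simp only: set_map set_upt image_comp[symmetric] bij_betw_imp_surj_on)
  have "map (f \<circ> \<sigma>) [1..<Suc n] = map (f \<circ> \<tau>) [1..<Suc n]"
    by (rule strict_sorted_equal) (use srt img assms in \<open>simp_all only:\<close>)
  then have eq: "f (\<sigma> i) = f (\<tau> i)" if "i \<in> {1..n}" for i
    using that by (simp only: map_eq_conv set_upt comp_def)
  show ?thesis
  proof (rule PiE_ext[OF assms(2,5)])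
    fix i assume i: "i \<in> {1..n}"
    then have "\<sigma> i \<in> P" "\<tau> i \<in> P" using assms(2,5) by auto
    then show "\<sigma> i = \<tau> i" using eq[OF i] assms(1) by (simp add: inj_on_eq_iff)
  qed
qed

section \<open>Almost every point has no accidental ties\<close>

lemma AE_component_neq:
  assumes "finite V" "u \<notin> V" and [measurable]: "g \<in> borel_measurable (PiM V (\<lambda>_. lborel))"
  shows "AE x in PiM (insert u V) (\<lambda>_. lborel). x u \<noteq> (g (restrict x V) :: real)"
proof (rule AE_I')
  interpret product_sigma_finite "\<lambda>_::'a. lborel :: real measure" ..
  let ?M = "\<lambda>U. PiM U (\<lambda>_. lborel :: real measure)"
  \<comment> \<open>The exceptional set is the graph of \<open>g\<close>. Its sections in the
    direction of \<open>u\<close> are single points, so it is null by Fubini.\<close>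
  let ?N = "{x \<in> space (?M (insert u V)). x u = g (restrict x V)}"
  have [measurable]: "(\<lambda>x. restrict x V) \<in> measurable (?M (insert u V)) (?M V)"
    by (rule measurable_restrict_subset) auto
  have N: "?N \<in> sets (?M (insert u V))" by measurable
  have sec: "x(u := y) \<in> ?N \<longleftrightarrow> y = g x" if "x \<in> space (?M V)" for x y
  proof -
    have "restrict (x(u := y)) V = x"
      using that assms(2) by (auto simp: space_PiM PiE_def extensional_def restrict_def fun_eq_iff)
    moreover have "x(u := y) \<in> space (?M (insert u V))"
      using that by (auto simp: space_PiM PiE_def extensional_def)
    ultimately show ?thesis by simp
  qed
  have "emeasure (?M (insert u V)) ?N = (\<integral>\<^sup>+x. indicator ?N x \<partial>?M (insert u V))"
    using N by simp
  also have "\<dots> = (\<integral>\<^sup>+x. (\<integral>\<^sup>+y. indicator ?N (x(u := y)) \<partial>lborel) \<partial>?M V)"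
    using assms(1,2) N by (intro product_nn_integral_insert) auto
  also have "\<dots> = (\<integral>\<^sup>+x. 0 \<partial>?M V)"
  proof (rule nn_integral_cong)
    fix x assume "x \<in> space (?M V)"
    then have "(\<integral>\<^sup>+y. indicator ?N (x(u := y)) \<partial>lborel) = (\<integral>\<^sup>+y. indicator {g x} y \<partial>lborel)"
      by (intro nn_integral_cong) (simp only: indicator_def sec singleton_iff)
    then show "(\<integral>\<^sup>+y. indicator ?N (x(u := y)) \<partial>lborel) = 0" by simp
  qed
  finally show "?N \<in> null_sets (?M (insert u V))" using N by (auto simp: null_sets_def)
qed auto

text \<open>The value at \<open>v\<close> is either a constant or another coordinate, hence a
  measurable function of the coordinates other than \<open>u\<close>.\<close>

lemma AE_marked_ext_neq:
  assumes "finite U" "u \<in> U" "u \<notin> A" "v \<noteq> u" "v \<in> A \<or> v \<in> U"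
  shows "AE x in PiM U (\<lambda>_. lborel). marked_ext A lam x u \<noteq> marked_ext A lam x v"
proof -
  define V where "V = U - {u}"
  have V: "finite V" "u \<notin> V" "insert u V = U" "v \<in> A \<or> v \<in> V" using assms by (auto simp: V_def)
  have "AE x in PiM (insert u V) (\<lambda>_. lborel). x u \<noteq> marked_ext A lam (restrict x V) v"
    using V by (intro AE_component_neq marked_ext_measurable) auto
  moreover have "marked_ext A lam (restrict x V) v = marked_ext A lam x v" for x
    using V by (auto simp: marked_ext_def)
  moreover have "marked_ext A lam x u = x u" for x using assms(3) by (simp add: marked_ext_def)
  ultimately show ?thesis unfolding V(3) by simp
qed

subsection \<open>Linear extensions sorting a generic point\<close>

text \<open>The setting of the theorem with at least one marked element, so that \<open>p 1\<close>
  exists; the empty labelling is treated separately.\<close>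

locale marked_labelling =
  fixes P A :: "'a::order set" and lam :: "'a \<Rightarrow> real" and p :: "nat \<Rightarrow> 'a" and k :: nat
  assumes marked: "marked_poset P A lam"
    and A_eq: "A = p ` {1..k}" and inj_p: "inj_on p {1..k}"
    and lam_dec: "\<forall>i\<in>{1..<k}. lam (p (i + 1)) \<le> lam (p i)"
    and p_order: "\<forall>i\<in>{1..k}. \<forall>j\<in>{1..k}. p j < p i \<longrightarrow> i < j"
    and k_pos: "0 < k"
begin

abbreviation "ext \<equiv> marked_ext A lam"
abbreviation "n \<equiv> card P"
abbreviation "M \<equiv> PiM (P - A) (\<lambda>_. lborel :: real measure)"

text \<open>The position prescribed for \<open>p j\<close>. Labels count from 1 and list indices
  from 0, so \<open>as ! (j - 1)\<close> is the number of letters strictly between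
  \<open>p j\<close> and \<open>p (j + 1)\<close>.\<close>

definition pos :: "nat list \<Rightarrow> nat \<Rightarrow> nat" where
  "pos as j = j + sum_list (take (j - 1) as)"

definition placed_extensions :: "nat list \<Rightarrow> (nat \<Rightarrow> 'a) set" where
  "placed_extensions as = {\<sigma> \<in> linear_extensions P. \<forall>j\<in>{1..k}. pos as j \<le> n \<and> \<sigma> (pos as j) = p j}"

definition chain :: "(nat \<Rightarrow> 'a) \<Rightarrow> ('a \<Rightarrow> real) set" where
  "chain \<sigma> = {x \<in> space M. \<forall>i j. 1 \<le> i \<longrightarrow> i < j \<longrightarrow> j \<le> n \<longrightarrow> ext x (\<sigma> j) \<le> ext x (\<sigma> i)}"

text \<open>One of the two elements must be free: two marked elements may share a value, and then
  they tie at every point.\<close>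

definition generic :: "('a \<Rightarrow> real) set" where
  "generic = {x \<in> space M. \<forall>u\<in>P - A. \<forall>v\<in>P. u \<noteq> v \<longrightarrow> ext x u \<noteq> ext x v}"

definition mono_points :: "('a \<Rightarrow> real) set" where
  "mono_points = {x \<in> space M. \<forall>q\<in>P. \<forall>r\<in>P. q < r \<longrightarrow> ext x q \<le> ext x r}"

text \<open>Sorting by this key lists the elements by decreasing coordinate and breaks ties between
  marked elements by their label; for a generic point no other ties occur.\<close>

definition key :: "('a \<Rightarrow> real) \<Rightarrow> 'a \<Rightarrow> real list" where
  "key x q = [- ext x q, if q \<in> A then real (inv_into {1..k} p q) else 0]"

lemma finite_P: "finite P" and A_sub: "A \<subseteq> P"
  using marked by (auto simp: marked_poset_def)

lemma p_in_A [simp]: "j \<in> {1..k} \<Longrightarrow> p j \<in> A"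
  by (simp add: A_eq)

lemma p_in_P [simp]: "j \<in> {1..k} \<Longrightarrow> p j \<in> P"
  by (rule subsetD[OF A_sub p_in_A])

lemma lam_antimono:
  assumes "1 \<le> i" "i \<le> j" "j \<le> k"
  shows "lam (p j) \<le> lam (p i)"
  using assms(2,3)
proof (induction j rule: dec_induct)
  case (step m)
  have "m \<in> {1..<k}" using step assms(1) by simp
  then have "lam (p (Suc m)) \<le> lam (p m)" using lam_dec by simp
  also have "\<dots> \<le> lam (p i)" using step by simp
  finally show ?case .
qed simp

lemma key_less_iff:
  "key x q < key x r \<longleftrightarrow> ext x r < ext x q \<or>
     ext x q = ext x r \<and>
     (if q \<in> A then inv_into {1..k} p q else 0) < (if r \<in> A then inv_into {1..k} p r else 0)"
proof -
  have "[a, real b] < [c, real d] \<longleftrightarrow> a < c \<or> a = c \<and> b < d" for a b c d by simp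
  moreover have "key x q = [- ext x q, real (if q \<in> A then inv_into {1..k} p q else 0)]" for q
    by (simp add: key_def)
  ultimately show ?thesis by (simp only: neg_less_iff_less neg_equal_iff_equal)
qed

lemma inv_p [simp]: "j \<in> {1..k} \<Longrightarrow> inv_into {1..k} p (p j) = j"
  using inj_p by simp

lemmas inv_p_Suc [simp] = inv_p[unfolded One_nat_def]

lemma generic_tie:
  assumes "x \<in> generic" "q \<in> P" "r \<in> P" "q \<noteq> r" "ext x q = ext x r"
  shows "q \<in> A" "r \<in> A"
proof -
  have neq: "ext x u \<noteq> ext x v" if "u \<in> P - A" "v \<in> P" "u \<noteq> v" for u v
    using assms(1) that by (simp add: generic_def)
  show "q \<in> A" using neq[of q r] assms(2-5) by blast
  show "r \<in> A" using neq[of r q] assms(2-5) by (metis DiffI)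
qed

text \<open>At a generic point equal first entries occur only between marked elements, and the
  second entries separate these by label.\<close>

lemma key_inj:
  assumes "x \<in> generic"
  shows "inj_on (key x) P"
proof (rule inj_onI, rule ccontr)
  fix q r assume qr: "q \<in> P" "r \<in> P" "key x q = key x r" "q \<noteq> r"
  have "ext x q = ext x r" using qr(3) by (simp add: key_def)
  from generic_tie[OF assms qr(1,2,4) this] have "q \<in> A" "r \<in> A" .
  with qr(3) have "inv_into {1..k} p q = inv_into {1..k} p r" by (simp add: key_def)
  then have "q = r"
    using \<open>q \<in> A\<close> \<open>r \<in> A\<close> by (intro inv_into_injective[of "{1..k}" p]) (simp_all only: A_eq)
  with qr(4) show False ..
qed

lemma pos_less: "1 \<le> i \<Longrightarrow> i < j \<Longrightarrow> pos as i < pos as j"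
  using sum_list_take_mono[of "i - 1" "j - 1" as] diff_le_mono[of i j 1] by (simp add: pos_def)

lemma pos_1: "pos as 1 = 1"
  by (simp add: pos_def)

lemma pos_Suc: "1 \<le> j \<Longrightarrow> j \<le> length as \<Longrightarrow> pos as (Suc j) = Suc (pos as j + as ! (j - 1))"
  by (cases j) (simp_all add: pos_def take_Suc_conv_app_nth)

lemma linear_extensionD:
  assumes "\<sigma> \<in> linear_extensions P"
  shows "bij_betw \<sigma> {1..n} P" "\<sigma> \<in> {1..n} \<rightarrow>\<^sub>E P"
    "\<And>i j. i \<in> {1..n} \<Longrightarrow> j \<in> {1..n} \<Longrightarrow> \<sigma> i < \<sigma> j \<Longrightarrow> j < i"
  using assms by (auto simp: linear_extensions_def)

lemma P_ex_index:
  assumes "bij_betw \<sigma> {1..n} P" "q \<in> P"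
  obtains i where "i \<in> {1..n}" "q = \<sigma> i"
  using assms unfolding bij_betw_def by blast

lemma n_pos: "0 < n"
proof -
  have "p 1 \<in> P" using k_pos by (intro p_in_P) auto
  then show ?thesis using finite_P card_gt_0_iff by blast
qed

text \<open>Linear extensions reverse the order, so nothing lies above the first element. It is
  maximal and therefore marked.\<close>

lemma first_marked:
  assumes "\<sigma> \<in> linear_extensions P"
  shows "\<sigma> 1 \<in> A"
proof -
  note \<sigma> = linear_extensionD[OF assms]
  have 1: "1 \<in> {1..n}" using n_pos by auto
  have "\<not> \<sigma> 1 < q" if "q \<in> P" for q
  proof
    assume "\<sigma> 1 < q"
    moreover obtain i where "i \<in> {1..n}" "q = \<sigma> i" by (rule P_ex_index[OF \<sigma>(1) \<open>q \<in> P\<close>])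
    ultimately show False using \<sigma>(3)[OF 1] by force
  qed
  moreover have "\<sigma> 1 \<in> P" using \<sigma>(2) 1 by blast
  ultimately show ?thesis using marked by (auto simp: marked_poset_def)
qed

lemma last_marked:
  assumes "\<sigma> \<in> linear_extensions P"
  shows "\<sigma> n \<in> A"
proof -
  note \<sigma> = linear_extensionD[OF assms]
  have n: "n \<in> {1..n}" using n_pos by auto
  have "\<not> q < \<sigma> n" if "q \<in> P" for q
  proof
    assume "q < \<sigma> n"
    moreover obtain i where "i \<in> {1..n}" "q = \<sigma> i" by (rule P_ex_index[OF \<sigma>(1) \<open>q \<in> P\<close>])
    ultimately show False using \<sigma>(3)[OF _ n] by force
  qed
  moreover have "\<sigma> n \<in> P" using \<sigma>(2) n by blast
  ultimately show ?thesis using marked by (auto simp: marked_poset_def)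
qed

section \<open>The chain of one linear extension with prescribed marked positions\<close>

context
  fixes as \<sigma>
  assumes len: "length as = k - 1" and placed: "\<sigma> \<in> placed_extensions as"
begin

lemma placed_linear: "\<sigma> \<in> linear_extensions P"
  using placed by (simp add: placed_extensions_def)

lemma placed_pos: "j \<in> {1..k} \<Longrightarrow> pos as j \<in> {1..n} \<and> \<sigma> (pos as j) = p j"
  using placed by (auto simp: placed_extensions_def pos_def)

lemma placed_eq_p_iff:
  assumes "i \<in> {1..n}" "j \<in> {1..k}"
  shows "\<sigma> i = p j \<longleftrightarrow> i = pos as j"
  using linear_extensionD(1)[OF placed_linear] placed_pos[OF assms(2)] assms(1)
  by (metis bij_betw_imp_inj_on inj_onD)

text \<open>The last element is marked, and among the marked elements \<open>p k\<close> comes last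
  because \<open>pos as\<close> is increasing.\<close>

lemma pos_k: "pos as k = n"
proof -
  have n: "n \<in> {1..n}" using n_pos by auto
  obtain j where j: "j \<in> {1..k}" "\<sigma> n = p j" using last_marked[OF placed_linear] by (auto simp: A_eq)
  then have "n = pos as j" using placed_eq_p_iff n by blast
  also have "\<dots> \<le> pos as k" using pos_less[of j k as] j by (cases "j = k") auto
  finally show ?thesis using placed_pos[of k] k_pos by auto
qed

text \<open>This bounds the gap lists that occur, so the sum in the theorem has finite
  support.\<close>

lemma card_P_eq: "n = k + sum_list as"
  using pos_k len by (simp add: pos_def)

text \<open>The weak inequalities of the chain become strict comparisons of keys. A tie at a generic
  point involves two marked elements, and \<open>\<sigma>\<close> lists these in the order of their
  labels, as the key does.\<close>

lemma chain_iff_key: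
  assumes x: "x \<in> generic"
  shows "x \<in> chain \<sigma> \<longleftrightarrow> (\<forall>i j. 1 \<le> i \<longrightarrow> i < j \<longrightarrow> j \<le> n \<longrightarrow> key x (\<sigma> i) < key x (\<sigma> j))"
    (is "_ \<longleftrightarrow> ?R")
proof
  assume ?R
  then have "key x (\<sigma> i) < key x (\<sigma> j)" if "1 \<le> i" "i < j" "j \<le> n" for i j
    using that by blast
  then have "ext x (\<sigma> j) \<le> ext x (\<sigma> i)" if "1 \<le> i" "i < j" "j \<le> n" for i j
    using that by (force simp: key_def)
  then show "x \<in> chain \<sigma>"
    using x by (simp add: chain_def generic_def)
next
  assume ch: "x \<in> chain \<sigma>"
  show ?R
  proof (intro allI impI)
    fix i j assume ij: "1 \<le> i" "i < j" "j \<le> n"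
    then have ij': "i \<in> {1..n}" "j \<in> {1..n}" by auto
    have le: "ext x (\<sigma> j) \<le> ext x (\<sigma> i)" using ch ij by (simp add: chain_def)
    note \<sigma> = linear_extensionD[OF placed_linear]
    show "key x (\<sigma> i) < key x (\<sigma> j)"
    proof (cases "ext x (\<sigma> i) = ext x (\<sigma> j)")
      case True
      have "\<sigma> i \<in> P" "\<sigma> j \<in> P" using \<sigma>(2) ij' by blast+
      moreover have "\<sigma> i \<noteq> \<sigma> j"
        using inj_on_eq_iff[OF bij_betw_imp_inj_on[OF \<sigma>(1)] ij'] ij(2) by simp
      ultimately have "\<sigma> i \<in> A" "\<sigma> j \<in> A" using generic_tie[OF x _ _ _ True] by blast+
      then obtain a b where
        ab: "a \<in> {1..k}" "\<sigma> i = p a" "b \<in> {1..k}" "\<sigma> j = p b" by (auto simp: A_eq)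
      have "i = pos as a" "j = pos as b"
        using placed_eq_p_iff[OF ij'(1) ab(1)] placed_eq_p_iff[OF ij'(2) ab(3)] ab(2,4) by simp_all
      then have "a < b" using pos_less[of b a as] ij(2) ab
        by (cases a b rule: linorder_cases) auto
      then show ?thesis using True ab by (simp add: key_less_iff)
    qed (use le in \<open>auto simp: key_less_iff\<close>)
  qed
qed

lemma chain_mono: "chain \<sigma> \<subseteq> mono_points"
proof
  fix x assume x: "x \<in> chain \<sigma>"
  note \<sigma> = linear_extensionD[OF placed_linear]
  have "ext x q \<le> ext x r" if "q \<in> P" "r \<in> P" "q < r" for q r
  proof -
    obtain i where i: "i \<in> {1..n}" "q = \<sigma> i" by (rule P_ex_index[OF \<sigma>(1) \<open>q \<in> P\<close>])
    obtain j where j: "j \<in> {1..n}" "r = \<sigma> j" by (rule P_ex_index[OF \<sigma>(1) \<open>r \<in> P\<close>])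
    note ij = i j
    then have "j < i" using \<sigma>(3) \<open>q < r\<close> by blast
    then show ?thesis using x ij by (simp add: chain_def)
  qed
  then show "x \<in> mono_points" using x by (auto simp: chain_def mono_points_def)
qed

lemma set_word: "set (map \<sigma> [1..<Suc n]) = P"
proof -
  have "set [1..<Suc n] = {1..n}" by auto
  then show ?thesis using linear_extensionD(1)[OF placed_linear] by (simp only: set_map bij_betw_def)
qed

text \<open>The word of \<open>\<sigma>\<close> starts with \<open>p 1\<close>, so the bound
  \<open>lam (p 1)\<close> is attained by the first letter; the rest is a shift between positions
  from 1 and list indices from 0.\<close>

lemma chain_eq_region: "chain \<sigma> = chain_region A lam (lam (p 1)) (map \<sigma> [1..<Suc n])"
proof -
  have \<sigma>1: "\<sigma> 1 = p 1" using placed_pos[of 1] k_pos pos_1[of as] by simp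
  have ext1: "ext x (p 1) = lam (p 1)" for x using k_pos by (simp add: marked_ext_def)
  have up: "[1..<Suc n] = 1 # [2..<Suc n]" using n_pos by (simp add: upt_conv_Cons numeral_2_eq_2 del: upt_Suc)
  have "sorted_wrt (\<ge>) (lam (p 1) # map (ext x) (map \<sigma> [1..<Suc n])) \<longleftrightarrow>
      (\<forall>i j. 1 \<le> i \<longrightarrow> i < j \<longrightarrow> j \<le> n \<longrightarrow> ext x (\<sigma> j) \<le> ext x (\<sigma> i))" for x
  proof -
    have "sorted_wrt (\<ge>) (lam (p 1) # lam (p 1) # xs) \<longleftrightarrow> sorted_wrt (\<ge>) (lam (p 1) # xs)" for xs
      by auto
    then have "sorted_wrt (\<ge>) (lam (p 1) # map (ext x) (map \<sigma> [1..<Suc n])) \<longleftrightarrow>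
        sorted_wrt (\<ge>) (map (ext x) (map \<sigma> [1..<Suc n]))"
      by (simp only: up list.map \<sigma>1 ext1)
    also have "\<dots> \<longleftrightarrow> (\<forall>i j. i < j \<longrightarrow> j < n \<longrightarrow> ext x (\<sigma> (Suc j)) \<le> ext x (\<sigma> (Suc i)))"
      by (simp add: sorted_wrt_iff_nth_less del: upt_Suc)
    also have "\<dots> \<longleftrightarrow> (\<forall>i j. 1 \<le> i \<longrightarrow> i < j \<longrightarrow> j \<le> n \<longrightarrow> ext x (\<sigma> j) \<le> ext x (\<sigma> i))" (is "?L \<longleftrightarrow> ?R")
    proof
      assume L: ?L
      show ?R
      proof (intro allI impI)
        fix i j :: nat assume "1 \<le> i" "i < j" "j \<le> n"
        then show "ext x (\<sigma> j) \<le> ext x (\<sigma> i)" using L[rule_format, of "i - 1" "j - 1"] by simp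
      qed
    qed auto
    finally show ?thesis .
  qed
  then show ?thesis by (simp only: chain_def chain_region_def set_word)
qed

text \<open>The marked letters of the word of \<open>\<sigma>\<close> sit exactly at the positions
  given by \<open>pos as\<close>, so the entries of \<open>as\<close> are the lengths of its free
  runs.\<close>

lemma emeasure_chain:
  "emeasure M (chain \<sigma>) =
    ennreal (\<Prod>i\<in>{1..k - 1}. (lam (p i) - lam (p (i + 1))) ^ (as ! (i - 1)) / fact (as ! (i - 1)))"
proof -
  let ?ws = "map \<sigma> [1..<Suc n]"
  note \<sigma> = linear_extensionD[OF placed_linear]
  have set_upt: "set [1..<Suc n] = {1..n}" by auto
  have nth_ws: "?ws ! i = \<sigma> (Suc i)" if "i < n" for i using that by (simp del: upt_Suc)
  have posS: "pos as (Suc j) = Suc (j + sum_list (take j as))" for j by (simp add: pos_def)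
  have "emeasure (PiM (set ?ws - A) (\<lambda>_. lborel)) (chain_region A lam (lam (p (Suc 0))) ?ws) =
    ennreal (\<Prod>i<length as. (lam (p (Suc i)) - lam (p (Suc (Suc i)))) ^ (as ! i) / fact (as ! i))"
  proof (rule emeasure_chain_region[where q = "\<lambda>i. p (Suc i)"])
    show "distinct ?ws"
      using \<sigma>(1) by (simp only: distinct_map set_upt distinct_upt bij_betw_def simp_thms)
    show "p (Suc j) \<in> A" if "j \<le> length as" for j using that len k_pos by (intro p_in_A) auto
    show "?ws ! (j + sum_list (take j as)) = p (Suc j)" if "j \<le> length as" for j
    proof -
      have "Suc j \<in> {1..k}" using that len k_pos by auto
      from placed_pos[OF this] show ?thesis by (subst nth_ws) (simp_all add: posS del: upt_Suc)
    qed
    show "length ?ws = Suc (length as + sum_list as)" using card_P_eq len k_pos by simp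
    show "\<exists>j\<le>length as. i = j + sum_list (take j as)" if "i < length ?ws" "?ws ! i \<in> A" for i
    proof -
      have i: "i < n" "\<sigma> (Suc i) \<in> A" using that by (auto simp: nth_ws simp del: upt_Suc)
      then obtain j where j: "j \<in> {1..k}" "\<sigma> (Suc i) = p j" by (auto simp: A_eq)
      then have "Suc i = pos as j" using placed_eq_p_iff[of "Suc i" j] i by auto
      then show ?thesis using j len by (intro exI[of _ "j - 1"]) (auto simp: pos_def)
    qed
    show "lam (p (Suc (Suc j))) \<le> lam (p (Suc j))" if "j < length as" for j
      using that len by (intro lam_antimono) auto
  qed
  also have "(\<Prod>i<length as. (lam (p (Suc i)) - lam (p (Suc (Suc i)))) ^ (as ! i) / fact (as ! i)) =
    (\<Prod>i\<in>{1..k - 1}. (lam (p i) - lam (p (i + 1))) ^ (as ! (i - 1)) / fact (as ! (i - 1)))"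
    by (rule prod.reindex_bij_witness[where i = "\<lambda>i. i - 1" and j = Suc]) (auto simp: len)
  finally show ?thesis by (simp only: chain_eq_region set_word[unfolded One_nat_def] One_nat_def)
qed

lemma chain_sets: "chain \<sigma> \<in> sets M"
  using chain_region_sets[of A lam "lam (p 1)" "map \<sigma> [1..<Suc n]"]
  by (simp only: chain_eq_region set_word)

end

section \<open>Every generic point of the polytope lies in exactly one chain\<close>

lemma placed_extensions_finite: "finite (placed_extensions as)"
proof (rule finite_subset)
  show "placed_extensions as \<subseteq> {1..n} \<rightarrow>\<^sub>E P"
    by (auto simp: placed_extensions_def linear_extensions_def)
qed (simp add: finite_PiE finite_P)

text \<open>The extension determines where each \<open>p j\<close> sits, and the gaps between
  consecutive marked positions give back the list.\<close>

lemma placed_extensions_disjoint: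
  assumes "length as = k - 1" "length bs = k - 1"
    and "\<sigma> \<in> placed_extensions as" "\<sigma> \<in> placed_extensions bs"
  shows "as = bs"
proof (rule nth_equalityI)
  have eq: "pos as j = pos bs j" if "j \<in> {1..k}" for j
    using placed_eq_p_iff[OF assms(1,3) _ that] placed_pos[OF assms(2,4) that] by auto
  fix i assume i: "i < length as"
  then have "pos as (Suc i) = pos bs (Suc i)" "pos as (Suc (Suc i)) = pos bs (Suc (Suc i))"
    using assms(1) by (auto intro!: eq)
  then show "as ! i = bs ! i" using i assms(1,2) by (simp add: pos_Suc)
qed (simp add: assms)

text \<open>Sorting \<open>P\<close> by \<open>key x\<close> gives the extension. Monotonicity of
  \<open>x\<close> makes it a linear extension, and the decreasing marked values put the marked
  elements in the order of their labels.\<close>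

lemma generic_sorting:
  assumes x: "x \<in> generic" and mono: "x \<in> mono_points"
  obtains as \<sigma> where "length as = k - 1" "\<sigma> \<in> placed_extensions as" "x \<in> chain \<sigma>"
proof -
  obtain \<sigma> where \<sigma>: "\<sigma> \<in> {1..n} \<rightarrow>\<^sub>E P" "bij_betw \<sigma> {1..n} P"
    and key: "\<And>i j. 1 \<le> i \<Longrightarrow> i < j \<Longrightarrow> j \<le> n \<Longrightarrow> key x (\<sigma> i) < key x (\<sigma> j)"
    by (rule ex_increasing_enum[OF finite_P key_inj[OF x]]) blast
  have less: "i < j" if "key x (\<sigma> i) < key x (\<sigma> j)" "i \<in> {1..n}" "j \<in> {1..n}" for i j
    using key[of j i] that by (cases i j rule: linorder_cases) auto
  have lin: "\<sigma> \<in> linear_extensions P"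
    unfolding linear_extensions_def
  proof (intro CollectI conjI ballI impI)
    fix i j assume ij: "i \<in> {1..n}" "j \<in> {1..n}" "\<sigma> i < \<sigma> j"
    have P: "\<sigma> i \<in> P" "\<sigma> j \<in> P" using \<sigma>(1) ij by auto
    then have le: "ext x (\<sigma> i) \<le> ext x (\<sigma> j)" using mono ij(3) by (auto simp: mono_points_def)
    \<comment> \<open>If the values tie, both elements are marked, and \<open>p_order\<close> gives
      the larger one the smaller label.\<close>
    have "key x (\<sigma> j) < key x (\<sigma> i)"
    proof (cases "ext x (\<sigma> i) = ext x (\<sigma> j)")
      case True
      have "\<sigma> i \<noteq> \<sigma> j" using ij(3) by auto
      from generic_tie[OF x P this True] obtain a b where
        ab: "a \<in> {1..k}" "\<sigma> i = p a" "b \<in> {1..k}" "\<sigma> j = p b" by (auto simp: A_eq)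
      then have "b < a" using p_order ij(3) by auto
      then show ?thesis using True ab by (simp add: key_less_iff)
    qed (use le in \<open>auto simp: key_less_iff\<close>)
    then show "j < i" using less ij by blast
  qed (use \<sigma> in auto)
  define ip where "ip j = inv_into {1..n} \<sigma> (p j)" for j
  have ip: "ip j \<in> {1..n}" "\<sigma> (ip j) = p j" if "j \<in> {1..k}" for j
  proof -
    have "p j \<in> \<sigma> ` {1..n}" using p_in_P[OF that] \<sigma>(2) by (simp add: bij_betw_def)
    then show "ip j \<in> {1..n}" "\<sigma> (ip j) = p j"
      unfolding ip_def by (rule inv_into_into, rule f_inv_into_f)
  qed
  have ip_less: "ip i < ip j" if "1 \<le> i" "i < j" "j \<le> k" for i j
  proof -
    have ij: "i \<in> {1..k}" "j \<in> {1..k}" using that by auto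
    have "lam (p j) \<le> lam (p i)" using lam_antimono that by simp
    then have "key x (p i) < key x (p j)"
      using ij that by (auto simp: key_less_iff marked_ext_def)
    then show ?thesis using less[of "ip i" "ip j"] ip ij by simp
  qed
  \<comment> \<open>Some marked element comes first, and \<open>p 1\<close> precedes all other
    marked elements.\<close>
  have ip_1: "ip 1 = 1"
  proof -
    obtain j where j: "j \<in> {1..k}" "\<sigma> 1 = p j" using first_marked[OF lin] by (auto simp: A_eq)
    have "ip j = 1"
      using j ip[OF j(1)] \<sigma>(2) n_pos unfolding bij_betw_def by (intro inj_onD[of \<sigma> "{1..n}"]) auto
    moreover have "j = 1" using ip_less[of 1 j] ip(1)[of 1] j calculation by force
    ultimately show ?thesis by simp
  qed
  \<comment> \<open>The gaps between consecutive marked positions; the truncated subtraction is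
    exact because \<open>ip\<close> is strictly increasing.\<close>
  define as where "as = map (\<lambda>i. ip (Suc i) - ip i - 1) [1..<k]"
  have len: "length as = k - 1" by (simp add: as_def)
  have pos_ip: "pos as j = ip j" if "1 \<le> j" "j \<le> k" for j
    using that
  proof (induction j rule: dec_induct)
    case base
    then show ?case using ip_1 pos_1 by simp
  next
    case (step j)
    have "as ! (j - 1) = ip (Suc j) - ip j - 1"
    proof -
      have "[1..<k] ! (j - 1) = 1 + (j - 1)" by (rule nth_upt) (use step in auto)
      then show ?thesis using step by (simp add: as_def)
    qed
    then show ?case using step len ip_less[of j "Suc j"] by (simp add: pos_Suc)
  qed
  have "\<sigma> \<in> placed_extensions as"
    using lin ip by (simp add: placed_extensions_def pos_ip)
  moreover from this have "x \<in> chain \<sigma>" using chain_iff_key[OF len _ x] key by blast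
  ultimately show ?thesis using that len by blast
qed

text \<open>Both extensions list \<open>P\<close> by increasing key, and there is only one such
  listing.\<close>

lemma generic_chain_unique:
  assumes "x \<in> generic" "length as = k - 1" "length bs = k - 1"
    and "\<sigma> \<in> placed_extensions as" "\<tau> \<in> placed_extensions bs"
    and "x \<in> chain \<sigma>" "x \<in> chain \<tau>"
  shows "\<sigma> = \<tau>"
proof (rule increasing_enum_unique[OF key_inj[OF assms(1)], where n = n])
  note \<sigma> = linear_extensionD[OF placed_linear[OF assms(2,4)]] and \<tau> = linear_extensionD[OF placed_linear[OF assms(3,5)]]
  show "\<sigma> \<in> {1..n} \<rightarrow>\<^sub>E P" "bij_betw \<sigma> {1..n} P" "\<tau> \<in> {1..n} \<rightarrow>\<^sub>E P" "bij_betw \<tau> {1..n} P"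
    using \<sigma> \<tau> by auto
  show "key x (\<sigma> i) < key x (\<sigma> j)" "key x (\<tau> i) < key x (\<tau> j)" if "1 \<le> i" "i < j" "j \<le> n" for i j
    using chain_iff_key[OF assms(2,4,1)] chain_iff_key[OF assms(3,5,1)] assms(6,7) that by blast+
qed

subsection \<open>Decomposition of the polytope\<close>

lemma ext_measurable [measurable]: "q \<in> P \<Longrightarrow> (\<lambda>x. ext x q) \<in> borel_measurable M"
  by (rule marked_ext_measurable) auto

lemma AE_generic: "AE x in M. x \<in> generic"
proof -
  have "AE x in M. \<forall>u\<in>P - A. \<forall>v\<in>P. u \<noteq> v \<longrightarrow> ext x u \<noteq> ext x v"
  proof (intro AE_finite_allI)
    fix u v assume "u \<in> P - A" "v \<in> P"
    then show "AE x in M. u \<noteq> v \<longrightarrow> ext x u \<noteq> ext x v"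
      using AE_marked_ext_neq[of "P - A" u A v lam] finite_P by (cases "u = v") auto
  qed (simp_all add: finite_P)
  then show ?thesis by (rule AE_mp) (simp add: generic_def)
qed

lemma generic_sets: "generic \<in> sets M"
proof -
  have "(\<lambda>x. u \<noteq> v \<longrightarrow> ext x u \<noteq> ext x v) \<in> measurable M (count_space UNIV)" if [simp]: "u \<in> P" "v \<in> P" for u v
    unfolding pred_def
    using borel_measurable_neq[OF ext_measurable[OF that(1)] ext_measurable[OF that(2)]]
    by (cases "u = v") simp_all
  then have "Measurable.pred M (\<lambda>x. \<forall>u\<in>P - A. \<forall>v\<in>P. u \<noteq> v \<longrightarrow> ext x u \<noteq> ext x v)"
    using finite_P by (intro pred_intros_finite) auto
  then show ?thesis by (simp add: generic_def pred_def)
qed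

lemma mono_points_sets: "mono_points \<in> sets M"
proof -
  have "(\<lambda>x. q < r \<longrightarrow> ext x q \<le> ext x r) \<in> measurable M (count_space UNIV)" if [simp]: "q \<in> P" "r \<in> P" for q r
    unfolding pred_def
    using borel_measurable_le[OF ext_measurable[OF that(1)] ext_measurable[OF that(2)]]
    by (cases "q < r") simp_all
  then have "Measurable.pred M (\<lambda>x. \<forall>q\<in>P. \<forall>r\<in>P. q < r \<longrightarrow> ext x q \<le> ext x r)"
    using finite_P by (intro pred_intros_finite) auto
  then show ?thesis by (simp add: mono_points_def pred_def)
qed

text \<open>Forgetting the marked coordinates loses nothing, since \<open>ext\<close> restores
  them.\<close>

lemma proj_eq_mono_points: "proj_marked_order_polytope P A lam = mono_points"
proof (intro equalityI subsetI)
  fix y assume "y \<in> proj_marked_order_polytope P A lam"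
  then obtain x where x: "x \<in> marked_order_polytope P A lam" and y: "y = restrict x (P - A)"
    by (auto simp: proj_marked_order_polytope_def)
  have "ext y q = x q" if "q \<in> P" for q
    using x that by (auto simp: y marked_ext_def marked_order_polytope_def)
  then show "y \<in> mono_points"
    using x by (auto simp: mono_points_def marked_order_polytope_def y space_PiM)
next
  fix y assume y: "y \<in> mono_points"
  then have y_ext: "y \<in> extensional (P - A)" by (simp add: mono_points_def space_PiM PiE_def)
  have "restrict (ext y) P \<in> marked_order_polytope P A lam"
    unfolding marked_order_polytope_def
  proof (intro CollectI conjI ballI impI)
    fix q r assume "q \<in> P" "r \<in> P" "q < r"
    then show "restrict (ext y) P q \<le> restrict (ext y) P r"
      using y by (simp add: mono_points_def)
  next
    fix a assume "a \<in> A"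
    then show "restrict (ext y) P a = lam a" using A_sub by (auto simp: marked_ext_def)
  qed simp
  moreover have "y = restrict (restrict (ext y) P) (P - A)"
  proof (rule extensionalityI[OF y_ext])
    fix q assume "q \<in> P - A"
    then show "y q = restrict (restrict (ext y) P) (P - A) q" by (simp add: marked_ext_def)
  qed (simp only: restrict_extensional)
  ultimately show "y \<in> proj_marked_order_polytope P A lam"
    unfolding proj_marked_order_polytope_def by blast
qed

lemma weight_nonneg:
  "0 \<le> (\<Prod>i\<in>{1..k - 1}. (lam (p i) - lam (p (i + 1))) ^ (as ! (i - 1)) / fact (as ! (i - 1)))"
  using lam_dec by (intro prod_nonneg divide_nonneg_nonneg zero_le_power ballI) auto

lemma vol_proj_eq_infsum:
  "vol_proj P A lam =
    (\<Sum>\<^sub>\<infinity>as\<in>{as :: nat list. length as = k - 1}.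
       real (N_count P p k as) *
       (\<Prod>i\<in>{1..k - 1}. (lam (p i) - lam (p (i + 1))) ^ (as ! (i - 1)) / fact (as ! (i - 1))))"
proof -
  define w where "w as = (\<Prod>i\<in>{1..k - 1}. (lam (p i) - lam (p (i + 1))) ^ (as ! (i - 1)) / fact (as ! (i - 1)))" for as
  \<comment> \<open>A finite index set that contains every list with a placed extension.\<close>
  define T where "T = {as :: nat list. length as = k - 1 \<and> sum_list as \<le> n}"
  define I where "I = Sigma T placed_extensions"
  \<comment> \<open>Intersecting with the generic points makes the chains disjoint without changing
    their measure.\<close>
  define R where "R = (\<lambda>(as :: nat list, \<sigma>). chain \<sigma> \<inter> generic)"
  have N_count: "N_count P p k as = card (placed_extensions as)" for as
    by (simp add: N_count_def placed_extensions_def pos_def)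
  have T_I: "as \<in> T" if "length as = k - 1" "\<sigma> \<in> placed_extensions as" for as \<sigma>
    using card_P_eq[OF that] that(1) by (simp add: T_def)
  have "finite T"
  proof (rule finite_subset)
    show "T \<subseteq> {as. set as \<subseteq> {..n} \<and> length as = k - 1}"
      using member_le_sum_list by (force simp: T_def)
  qed (simp add: finite_lists_length_eq)
  then have fin: "finite I" by (simp add: I_def placed_extensions_finite)
  have I: "length as = k - 1" "\<sigma> \<in> placed_extensions as" if "(as, \<sigma>) \<in> I" for as \<sigma>
    using that by (auto simp: I_def T_def)
  have R_sets: "R ` I \<subseteq> sets M"
    using chain_sets[OF I] generic_sets by (auto simp: R_def)
  have emeasure_R: "emeasure M (R (as, \<sigma>)) = ennreal (w as)" if "(as, \<sigma>) \<in> I" for as \<sigma>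
  proof -
    have "emeasure M (R (as, \<sigma>)) = emeasure M (chain \<sigma>)"
      using AE_generic chain_sets[OF I[OF that]] generic_sets
      by (intro emeasure_eq_AE) (auto simp: R_def)
    then show ?thesis using emeasure_chain[OF I[OF that]] by (simp add: w_def)
  qed
  have mono_iff: "x \<in> mono_points \<longleftrightarrow> x \<in> (\<Union>i\<in>I. R i)" if x: "x \<in> generic" for x
  proof
    assume "x \<in> mono_points"
    from generic_sorting[OF x this] obtain as \<sigma>
      where "length as = k - 1" "\<sigma> \<in> placed_extensions as" "x \<in> chain \<sigma>" .
    then show "x \<in> (\<Union>i\<in>I. R i)"
      using T_I x by (intro UN_I[of "(as, \<sigma>)"]) (auto simp: I_def R_def)
  next
    assume "x \<in> (\<Union>i\<in>I. R i)"
    then show "x \<in> mono_points" using chain_mono[OF I] by (force simp: R_def)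
  qed
  have "disjoint_family_on R I"
    unfolding disjoint_family_on_def
  proof (intro ballI impI, rule ccontr)
    fix i j assume ij: "i \<in> I" "j \<in> I" "i \<noteq> j" "R i \<inter> R j \<noteq> {}"
    obtain as \<sigma> bs \<tau> where eq: "i = (as, \<sigma>)" "j = (bs, \<tau>)" by (metis surj_pair)
    obtain x where x: "x \<in> generic" "x \<in> chain \<sigma>" "x \<in> chain \<tau>"
      using ij(4) by (auto simp: eq R_def)
    note as = I[OF ij(1)[unfolded eq]] and bs = I[OF ij(2)[unfolded eq]]
    have "\<sigma> = \<tau>" using generic_chain_unique[OF x(1) as(1) bs(1) as(2) bs(2) x(2,3)] .
    moreover from this have "as = bs" using placed_extensions_disjoint[OF as(1) bs(1) as(2)] bs(2) by simp
    ultimately show False using ij(3) eq by simp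
  qed
  have "vol_proj P A lam = measure M mono_points"
    by (simp add: vol_proj_def proj_eq_mono_points)
  also have "\<dots> = measure M (\<Union>i\<in>I. R i)"
  proof (rule measure_eq_AE)
    show "AE x in M. x \<in> mono_points \<longleftrightarrow> x \<in> (\<Union>i\<in>I. R i)"
      using AE_generic by (rule AE_mp) (rule AE_I2, use mono_iff in blast)
    show "(\<Union>i\<in>I. R i) \<in> sets M" using fin R_sets by (intro sets.finite_UN) auto
  qed (fact mono_points_sets)
  also have "\<dots> = (\<Sum>i\<in>I. measure M (R i))"
    using fin R_sets \<open>disjoint_family_on R I\<close> emeasure_R
    by (intro measure_finite_Union) auto
  also have "\<dots> = (\<Sum>(as, \<sigma>)\<in>I. w as)"
    using emeasure_R weight_nonneg by (intro sum.cong) (auto simp: measure_def w_def)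
  \<comment> \<open>The weight depends on \<open>as\<close> alone, so summing over the extensions
    counts them.\<close>
  also have "\<dots> = (\<Sum>as\<in>T. \<Sum>\<sigma>\<in>placed_extensions as. w as)"
    unfolding I_def using \<open>finite T\<close> placed_extensions_finite by (subst sum.Sigma) auto
  also have "\<dots> = (\<Sum>as\<in>T. real (N_count P p k as) * w as)"
    by (simp add: N_count)
  also have "\<dots> = (\<Sum>\<^sub>\<infinity>as\<in>T. real (N_count P p k as) * w as)"
    using \<open>finite T\<close> by simp
  also have "\<dots> = (\<Sum>\<^sub>\<infinity>as\<in>{as. length as = k - 1}. real (N_count P p k as) * w as)"
  \<comment> \<open>Lists outside \<open>T\<close> have no placed extension, so their terms
    vanish.\<close>
  proof (rule infsum_cong_neutral)
    fix as assume "as \<in> {as. length as = k - 1} - T"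
    then have "placed_extensions as = {}" using T_I by blast
    then have "N_count P p k as = 0" by (simp add: N_count)
    then show "real (N_count P p k as) * w as = 0" by simp
  qed (auto simp: T_def)
  finally show ?thesis by (simp add: w_def)
qed

end

section \<open>The volume formula, including the empty labelling\<close>

theorem theorem3p4:
  fixes P A :: "'a::order set" and lam :: "'a \<Rightarrow> real" and p :: "nat \<Rightarrow> 'a" and k :: nat
  assumes "marked_poset P A lam"
    and "A = p ` {1..k}" and "inj_on p {1..k}"
    and "\<forall>i\<in>{1..<k}. lam (p (i + 1)) \<le> lam (p i)"
    and "\<forall>i\<in>{1..k}. \<forall>j\<in>{1..k}. p j < p i \<longrightarrow> i < j"
  shows "vol_proj P A lam =
    (\<Sum>\<^sub>\<infinity>as\<in>{as :: nat list. length as = k - 1}.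
       real (N_count P p k as) *
       (\<Prod>i\<in>{1..k - 1}. (lam (p i) - lam (p (i + 1))) ^ (as ! (i - 1)) / fact (as ! (i - 1))))"
proof (cases "k = 0")
  case False
  then interpret marked_labelling P A lam p k
    using assms by unfold_locales auto
  show ?thesis by (rule vol_proj_eq_infsum)
next
  case True
  interpret product_sigma_finite "\<lambda>_::'a. lborel :: real measure" ..
  have A: "A = {}" using assms(2) True by simp
  \<comment> \<open>A nonempty finite poset has a minimal element, which would be marked. With
    \<open>P\<close> empty both sides are 1: the volume of a point, and the single empty extension
    with an empty product.\<close>
  have P: "P = {}"
  proof (rule ccontr)
    assume "P \<noteq> {}"
    then obtain q where "q \<in> P" "\<forall>r\<in>P. r \<le> q \<longrightarrow> q = r"
      using assms(1) finite_has_minimal[of P] by (auto simp: marked_poset_def)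
    then have "q \<in> A" using assms(1) by (auto simp: marked_poset_def less_le)
    then show False using A by simp
  qed
  have "vol_proj P A lam = 1"
    by (simp add: vol_proj_def proj_marked_order_polytope_def marked_order_polytope_def A P PiM_empty measure_def)
  moreover have "N_count P p k [] = 1"
    by (simp add: N_count_def linear_extensions_def P True bij_betw_def)
  ultimately show ?thesis by (simp add: True)
qed

end
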